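(* Let $G$ be a connected graph of even order $n$ with minimum degree $\delta$, where $\delta \geq 2$ and $n \geq 7\delta - 7$. If $$q(G) \geq q\bigl(K_\delta \vee (K_{n-2\delta+1} \cup (\delta-1)K_1)\bigr),$$ then $G$ contains an even factor, unless $G = K_\delta \vee (K_{n-2\delta+1} \cup (\delta-1)K_1)$ (equality of graphs meaning isomorphism).
   Context: All graphs are finite, simple and undirected. The order of a graph is its number of vertices. The minimum degree of $G$ is $\min\{d_G(v) : v \in V(G)\}$, where $d_G(v)$ is the degree of $v$ in $G$. An even factor of $G$ is a spanning subgraph $F$ of $G$ such that for every vertex $v \in V(G)$ the degree $d_F(v)$ is a positive even integer (that is, $d_F(v) = 2k$ for some integer $k \geq 1$, where $k$ may depend on $v$). The signless Laplacian matrix of $G$ is $Q(G) = D(G) + A(G)$, where $A(G)$ is the adjacency matrix and $D(G)$ is the diagonal matrix of vertex degrees. The signless Laplacian spectral radius $q(G)$ is the largest eigenvalue of $Q(G)$. $K_m$ denotes the complete graph of order $m$. For vertex-disjoint graphs $G_1, G_2$, $G_1 \cup G_2$ is their disjoint union, and the join $G_1 \vee G_2$ is obtained from $G_1 \cup G_2$ by adding all edges between $V(G_1)$ and $V(G_2)$. $(\delta-1)K_1$ denotes the disjoint union of $\delta-1$ copies of $K_1$ (i.e. $\delta-1$ isolated vertices). *)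

theory Defs
  imports
    "HOL-Library.Countable_Set"
    "Graph_Theory.Digraph_Component"
    "Graph_Theory.Digraph_Isomorphism"
    "Jordan_Normal_Form.Spectral_Radius"
begin

text \<open>
  A finite simple undirected graph is a \<^locale>\<open>pair_graph\<close>: a finite, irreflexive, symmetric
  digraph whose arcs are pairs of vertices. Each undirected edge is represented by its two
  opposite arcs, so \<^const>\<open>out_degree\<close> counts the neighbours of a vertex.
\<close>

abbreviation degree_of :: "'a pair_pre_digraph \<Rightarrow> 'a \<Rightarrow> nat" where
  "degree_of G v \<equiv> out_degree (with_proj G) v"

abbreviation order_of :: "'a pair_pre_digraph \<Rightarrow> nat" where
  "order_of G \<equiv> card (pverts G)"

definition min_degree :: "'a pair_pre_digraph \<Rightarrow> nat" where
  "min_degree G = Min (degree_of G ` pverts G)"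

definition even_factor :: "'a pair_pre_digraph \<Rightarrow> 'a pair_pre_digraph \<Rightarrow> bool" where
  "even_factor F G \<longleftrightarrow> pair_graph F \<and> spanning (with_proj F) (with_proj G) \<and>
    (\<forall>v\<in>pverts G. \<exists>k\<ge>1. degree_of F v = 2 * k)"

text \<open>
  Matrices of \<open>Jordan_Normal_Form\<close> are indexed by \<open>0, \<dots>, n - 1\<close>; for a finite vertex set \<open>V\<close>,
  \<^term>\<open>from_nat_into V\<close> is a bijection from \<open>{..<card V}\<close> to \<open>V\<close>. Another
  enumeration of the vertices would conjugate the matrices below by a permutation matrix, which
  does not change the spectrum.
\<close>

definition adjacency_matrix :: "'a pair_pre_digraph \<Rightarrow> real mat" where
  "adjacency_matrix G = mat (order_of G) (order_of G)
    (\<lambda>(i, j). if (from_nat_into (pverts G) i, from_nat_into (pverts G) j) \<in> parcs G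
      then 1 else 0)"

definition degree_matrix :: "'a pair_pre_digraph \<Rightarrow> real mat" where
  "degree_matrix G = mat (order_of G) (order_of G)
    (\<lambda>(i, j). if i = j then real (degree_of G (from_nat_into (pverts G) i)) else 0)"

definition signless_laplacian :: "'a pair_pre_digraph \<Rightarrow> real mat" where
  "signless_laplacian G = degree_matrix G + adjacency_matrix G"

text \<open>
  The signless Laplacian is real symmetric, so its spectrum over the reals is its whole spectrum.
\<close>

definition signless_laplacian_radius :: "'a pair_pre_digraph \<Rightarrow> real" where
  "signless_laplacian_radius G = Max (spectrum (signless_laplacian G))"

definition complete_graph :: "nat \<Rightarrow> nat pair_pre_digraph" where
  "complete_graph m = \<lparr>pverts = {..<m}, parcs = {(i, j). i < m \<and> j < m \<and> i \<noteq> j}\<rparr>"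

text \<open>
  Sums and products of vertex types keep the vertex sets of the parts disjoint.
\<close>

definition disjoint_union ::
    "'a pair_pre_digraph \<Rightarrow> 'b pair_pre_digraph \<Rightarrow> ('a + 'b) pair_pre_digraph" where
  "disjoint_union G H = \<lparr>pverts = pverts G <+> pverts H,
    parcs = map_prod Inl Inl ` parcs G \<union> map_prod Inr Inr ` parcs H\<rparr>"

definition graph_join ::
    "'a pair_pre_digraph \<Rightarrow> 'b pair_pre_digraph \<Rightarrow> ('a + 'b) pair_pre_digraph" where
  "graph_join G H = \<lparr>pverts = pverts (disjoint_union G H),
    parcs = parcs (disjoint_union G H)
      \<union> Inl ` pverts G \<times> Inr ` pverts H \<union> Inr ` pverts H \<times> Inl ` pverts G\<rparr>"

definition copies :: "nat \<Rightarrow> 'a pair_pre_digraph \<Rightarrow> (nat \<times> 'a) pair_pre_digraph" where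
  "copies m G = \<lparr>pverts = {..<m} \<times> pverts G,
    parcs = {((i, u), (j, v)). i < m \<and> i = j \<and> (u, v) \<in> parcs G}\<rparr>"

definition extremal_graph :: "nat \<Rightarrow> nat \<Rightarrow> (nat + nat + nat \<times> nat) pair_pre_digraph" where
  "extremal_graph n \<delta> = graph_join (complete_graph \<delta>)
    (disjoint_union (complete_graph (n - 2 * \<delta> + 1)) (copies (\<delta> - 1) (complete_graph 1)))"

end

theory Submission
  imports Defs
begin

text \<open>
  Write \<open>d = \<delta> - 1\<close>. The extremal graph contains a clique on \<open>n - d\<close> vertices, so
  \<open>q(G) \<ge> 2 (n - 1 - d)\<close>. By Merris's bound some vertex \<open>v\<close> then satisfies
  \<open>d(v) + m(v) \<ge> 2 (n - 1 - d)\<close>, where \<open>m(v)\<close> is the average degree of its neighbours: the number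
  of non-neighbours of \<open>v\<close> plus the average number of non-neighbours of a neighbour of \<open>v\<close> is at
  most \<open>2 d\<close>. Such a graph has a spanning tree, of depth at most four and rooted at \<open>v\<close>, in which
  every vertex is incident with a non-tree edge. Removing from \<open>G\<close> those tree edges that repair
  the parities of the degrees leaves an even factor.
\<close>

section \<open>Even factors of dense graphs\<close>

lemma even_card_symmetric_irreflexive:
  assumes "finite F" "sym F" "irrefl F"
  shows "even (card F)"
  using assms
proof (induction F rule: finite_psubset_induct)
  case (psubset F)
  show ?case
  proof (cases "F = {}")
    case False
    then obtain u v where uv: "(u, v) \<in> F" by auto
    let ?e = "{(u, v), (v, u)}"
    have vu: "(v, u) \<in> F" using uv psubset.prems by (auto dest: symD)
    have "u \<noteq> v" using uv psubset.prems by (auto simp: irrefl_def)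
    then have "card ?e = 2" by simp
    moreover have "card F = card ?e + card (F - ?e)"
      using uv vu psubset.hyps card_mono[of F ?e] by (simp add: card_Diff_subset)
    moreover have "even (card (F - ?e))"
    proof (rule psubset.IH)
      show "F - ?e \<subset> F" using uv by auto
      show "sym (F - ?e)" using psubset.prems by (auto simp: sym_def)
      show "irrefl (F - ?e)" using psubset.prems by (auto simp: irrefl_def)
    qed
    ultimately show ?thesis by simp
  qed simp
qed

text \<open>Handshake lemma: the sum counts the arcs of \<open>F\<close>, which come in opposite
  pairs.\<close>

lemma even_sum_degrees:
  assumes "finite V" "F \<subseteq> V \<times> V" "sym F" "irrefl F"
  shows "even (\<Sum>v\<in>V. card (F `` {v}))"
proof -
  have fin: "finite F" using assms finite_subset by blast
  have "F = Sigma V (\<lambda>v. F `` {v})" using assms by auto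
  then have "card F = (\<Sum>v\<in>V. card (F `` {v}))"
    using card_SigmaI[of V "\<lambda>v. F `` {v}"] assms(1) fin by (simp add: finite_Image)
  then show ?thesis using even_card_symmetric_irreflexive[OF fin assms(3,4)] by simp
qed

lemma even_card_toggle:
  assumes "finite A"
  shows "even (card (sym_diff A {q})) \<longleftrightarrow> odd (card A)"
proof (cases "q \<in> A")
  case True
  then have "sym_diff A {q} = A - {q}" by auto
  moreover have "card A = Suc (card (A - {q}))" using True assms by (metis card_Suc_Diff1)
  ultimately show ?thesis by simp
next
  case False
  then have "sym_diff A {q} = insert q A" by auto
  then show ?thesis using False assms by simp
qed

text \<open>
  Start from all edges. Toggling the parent edge of a vertex of odd degree moves the defect towards
  the root, so the sum of the ranks of the odd vertices has no minimum other than one in which only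
  the root may be odd; that is excluded by parity. Non-tree edges are never removed.
\<close>

lemma even_spanning_subgraph_from_tree:
  fixes rank :: "'a \<Rightarrow> nat"
  assumes fin: "finite V" and EV: "E \<subseteq> V \<times> V" and sE: "sym E" and iE: "irrefl E"
    and par: "\<And>v. v \<in> V \<Longrightarrow> v \<noteq> r \<Longrightarrow> (v, p v) \<in> E \<and> rank (p v) < rank v"
    and nontree: "\<And>v. v \<in> V \<Longrightarrow> \<exists>u. (v, u) \<in> E \<and> u \<noteq> p v \<and> v \<noteq> p u"
  obtains F where "F \<subseteq> E" "sym F"
    "\<And>v. v \<in> V \<Longrightarrow> even (card (F `` {v})) \<and> F `` {v} \<noteq> {}"
proof -
  define P where "P F \<longleftrightarrow> F \<subseteq> E \<and> sym F \<and>
    (\<forall>v u. (v, u) \<in> E \<and> u \<noteq> p v \<and> v \<noteq> p u \<longrightarrow> (v, u) \<in> F)" for F :: "'a rel"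
  define c where "c F v = (if odd (card (F `` {v})) then rank v else 0)" for F :: "'a rel" and v
  define m where "m F = (\<Sum>v\<in>V. c F v)" for F
  have "P E" using sE by (auto simp: P_def)
  then obtain F where PF: "P F" and least: "\<And>F'. P F' \<Longrightarrow> m F \<le> m F'"
    using ex_has_least_nat[of P E m] by meson
  have FE: "F \<subseteq> E" and sF: "sym F" using PF by (auto simp: P_def)
  have finE: "finite E" using fin EV finite_subset by blast
  have finF: "finite (F `` {v})" for v using FE finE finite_subset by (metis finite_Image)
  have even_nonroot: "even (card (F `` {v}))" if v: "v \<in> V" "v \<noteq> r" for v
  proof (rule ccontr)
    assume odd: "odd (card (F `` {v}))"
    define q where "q = p v"
    have vq: "(v, q) \<in> E" "rank q < rank v" using par[OF v] by (auto simp: q_def)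
    have neq: "v \<noteq> q" and qV: "q \<in> V" and qv: "(q, v) \<in> E"
      using vq iE EV sE by (auto simp: irrefl_def dest: symD)
    define F' where "F' = sym_diff F {(v, q), (q, v)}"
    have "P F'" unfolding P_def
    proof (intro conjI allI impI)
      show "F' \<subseteq> E" using FE vq qv by (auto simp: F'_def)
      show "sym F'" using sF by (auto simp: F'_def sym_def)
      show "(a, b) \<in> F'" if "(a, b) \<in> E \<and> b \<noteq> p a \<and> a \<noteq> p b" for a b
        using that PF by (auto simp: F'_def P_def q_def)
    qed
    have im_v: "F' `` {v} = sym_diff (F `` {v}) {q}" using neq by (auto simp: F'_def)
    have im_o: "F' `` {w} = F `` {w}" if "w \<noteq> v" "w \<noteq> q" for w using that by (auto simp: F'_def)
    have cv: "c F' v = 0" "c F v = rank v"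
      using odd even_card_toggle[OF finF, of v q] by (auto simp: c_def im_v)
    have cq: "c F' q \<le> rank q" by (simp add: c_def)
    have co: "c F' w = c F w" if "w \<in> V - {v} - {q}" for w using that im_o[of w] by (simp add: c_def)
    have split: "m X = c X v + (c X q + (\<Sum>w\<in>V - {v} - {q}. c X w))" for X
      unfolding m_def using fin v neq qV
      by (simp add: sum.remove[where x = v] sum.remove[where x = q])
    \<comment> \<open>Toggling frees \<open>v\<close> of its rank, charges at most the smaller rank
      of \<open>q\<close>, and changes no other parity.\<close>
    have "m F' < m F" unfolding split[of F'] split[of F] using cv cq vq co by simp
    then show False using least[OF \<open>P F'\<close>] by simp
  qed
  \<comment> \<open>All other degrees are even and so is the degree sum, which leaves no odd
    root.\<close>
  have even_root: "even (card (F `` {r}))" if "r \<in> V"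
  proof -
    have "even (\<Sum>v\<in>V. card (F `` {v}))"
      using even_sum_degrees[OF fin, of F] FE EV sF iE by (auto simp: irrefl_def)
    moreover have "even (\<Sum>v\<in>V - {r}. card (F `` {v}))"
      using even_nonroot by (intro dvd_sum) auto
    ultimately show ?thesis using that fin by (simp add: sum.remove[where x = r])
  qed
  show thesis
  proof
    show "F \<subseteq> E" "sym F" by fact+
    fix v assume v: "v \<in> V"
    then obtain u where "(v, u) \<in> E" "u \<noteq> p v" "v \<noteq> p u" using nontree by blast
    then have "u \<in> F `` {v}" using PF by (auto simp: P_def)
    then show "even (card (F `` {v})) \<and> F `` {v} \<noteq> {}"
      using even_nonroot even_root v by blast
  qed
qed

section \<open>Spanning trees with a spare edge at every vertex\<close>

text \<open>By \<open>dense\<close>, the number of non-neighbours of \<open>v0\<close> plus its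
  average over the neighbours of \<open>v0\<close> is at most \<open>2 * d\<close>. Counting missing
  edges against this bound rules out every obstruction to the tree required by
  \<open>even_spanning_subgraph_from_tree\<close>.\<close>

lemma even_spanning_subgraph_of_dense:
  fixes E :: "'a rel" and d :: nat
  assumes fin: "finite V" and EV: "E \<subseteq> V \<times> V" and sE: "sym E" and iE: "irrefl E"
    and d: "d \<ge> 1" and large: "card V \<ge> 7 * d" "card V \<ge> 8"
    and min_deg: "\<And>v. v \<in> V \<Longrightarrow> card (E `` {v}) \<ge> d + 1"
    and v0: "v0 \<in> V"
    and dense: "(\<Sum>u\<in>E `` {v0}. card (V - E `` {v0} - {v0}) + card (V - E `` {u} - {u}))
      \<le> 2 * d * card (E `` {v0})"
  obtains F where "F \<subseteq> E" "sym F"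
    "\<And>v. v \<in> V \<Longrightarrow> even (card (F `` {v})) \<and> F `` {v} \<noteq> {}"
proof -
  \<comment> \<open>In the tree, the neighbours \<open>N\<close> of \<open>v0\<close> hang from \<open>v0\<close> (except \<open>x\<close> below), \<open>R1\<close> hangs from
    \<open>Z\<close> and \<open>R2\<close> hangs from \<open>R1\<close>. A vertex of \<open>Y\<close> has no edge inside \<open>N\<close> to spare, so it must
    stay a leaf.\<close>
  define N where "N = E `` {v0}"
  define R where "R = V - N - {v0}"
  define Y where "Y = {u \<in> N. E `` {u} \<inter> N = {}}"
  define Z where "Z = N - Y"
  define R1 where "R1 = {w \<in> R. E `` {w} \<inter> Z \<noteq> {}}"
  define R2 where "R2 = R - R1"
  define M where "M u = V - E `` {u} - {u}" for u
  have nbV: "E `` {u} \<subseteq> V" for u using EV by auto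
  have finnb: "finite (E `` {u})" for u using nbV fin finite_subset by blast
  have irr: "(u, u) \<notin> E" for u using iE by (auto simp: irrefl_def)
  have finN: "finite N" using finnb by (simp add: N_def)
  have finY: "finite Y" "finite Z" using finN by (auto simp: Y_def Z_def)
  have finR: "finite R" using fin by (simp add: R_def)
  have finR12: "finite R1" "finite R2" using finR by (auto simp: R1_def R2_def)
  have finM: "finite (M u)" for u using fin by (simp add: M_def)
  have v0N: "v0 \<notin> N" using irr by (auto simp: N_def)
  have NV: "N \<subseteq> V" using nbV by (simp add: N_def)
  define k b y r where "k = int (card N)" and "b = int (card R)"
    and "y = int (card Y)" and "r = int (card R2)"

  have "card V = card (insert v0 (N \<union> R))"
    using v0 NV by (intro arg_cong[where f = card]) (auto simp: R_def)
  also have "\<dots> = 1 + card N + card R"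
  proof -
    have "card (N \<union> R) = card N + card R" using finN finR by (intro card_Un_disjoint) (auto simp: R_def)
    then show ?thesis using finN finR v0N by (simp add: R_def)
  qed
  finally have cardV: "int (card V) = 1 + k + b" by (simp add: k_def b_def)
  have k_min: "k \<ge> d + 1" using min_deg[OF v0] by (simp add: k_def N_def)
  have dense': "(\<Sum>u\<in>N. int (card (M u))) + k * b \<le> 2 * d * k"
  proof -
    have "(\<Sum>u\<in>N. card R + card (M u)) \<le> 2 * d * card N"
      using dense by (simp add: N_def R_def M_def)
    then have "int (\<Sum>u\<in>N. card R + card (M u)) \<le> int (2 * d * card N)" by linarith
    then show ?thesis by (simp add: sum.distrib k_def b_def)
  qed
  have "0 \<le> (\<Sum>u\<in>N. int (card (M u)))" by (simp add: sum_nonneg)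
  then have "k * b \<le> k * (2 * d)" using dense' by (simp add: mult.commute)
  then have b_le: "b \<le> 2 * d" using k_min by simp
  have k_large: "k \<ge> d + 3" "k \<ge> 2 * d" using cardV b_le large d by linarith+
  have yk: "y \<le> k" "0 \<le> y" using finN by (auto simp: y_def k_def Y_def card_mono)
  have rb: "0 \<le> r" "r \<le> b" using finR by (auto simp: r_def b_def R2_def card_mono)

  \<comment> \<open>A vertex of \<open>Y\<close> has no neighbour in \<open>N\<close>, so it misses
    all of \<open>N\<close> but itself.\<close>
  have "int (card (M u)) \<ge> k - 1" if "u \<in> Y" for u
  proof -
    have "N - {u} \<subseteq> M u" using that NV by (auto simp: M_def Y_def)
    then have "card (N - {u}) \<le> card (M u)" by (simp add: card_mono finM)
    moreover have "card N = Suc (card (N - {u}))"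
      using that finN by (metis (no_types, lifting) Y_def card_Suc_Diff1 mem_Collect_eq)
    ultimately show ?thesis by (simp add: k_def)
  qed
  then have sumY: "y * (k - 1) \<le> (\<Sum>u\<in>Y. int (card (M u)))"
    using sum_bounded_below[of Y "k - 1" "\<lambda>u. int (card (M u))"] by (simp add: y_def)
  \<comment> \<open>A vertex of \<open>Z\<close> misses \<open>Y\<close>, whose vertices have no
    neighbour in \<open>N\<close>, and \<open>R2\<close>, whose vertices have no neighbour in
    \<open>Z\<close>.\<close>
  have "int (card (M u)) \<ge> y + r" if "u \<in> Z" for u
  proof -
    have "Y \<union> R2 \<subseteq> M u" using that NV sE by (auto simp: M_def Y_def Z_def R2_def R1_def R_def dest: symD)
    then have "card (Y \<union> R2) \<le> card (M u)" by (simp add: card_mono finM)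
    moreover have "card (Y \<union> R2) = card Y + card R2"
      using finY finR12 by (intro card_Un_disjoint) (auto simp: Y_def R2_def R_def)
    ultimately show ?thesis by (simp add: y_def r_def)
  qed
  then have "int (card Z) * (y + r) \<le> (\<Sum>u\<in>Z. int (card (M u)))"
    using sum_bounded_below[of Z "y + r" "\<lambda>u. int (card (M u))"] by simp
  moreover have "int (card Z) = k - y"
    using finN finY by (simp add: Z_def k_def y_def Y_def card_Diff_subset card_mono of_nat_diff)
  moreover have "(\<Sum>u\<in>N. int (card (M u))) = (\<Sum>u\<in>Y. int (card (M u))) + (\<Sum>u\<in>Z. int (card (M u)))"
    using finN sum.subset_diff[of Y N "\<lambda>u. int (card (M u))"] by (simp add: Z_def Y_def)
  \<comment> \<open>The central count of missing edges: the terms come from \<open>Y\<close>, from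
    \<open>Z\<close>, and from the \<open>b\<close> non-neighbours of \<open>v0\<close>, counted
    once for each of its \<open>k\<close> neighbours.\<close>
  ultimately have ineq: "y * (k - 1) + (k - y) * (y + r) + k * b \<le> 2 * d * k"
    using sumY dense' by simp

  \<comment> \<open>This will keep the children of a vertex of \<open>R1\<close>, all of them in
    \<open>R2\<close>, from using up its edges. Otherwise \<open>r + b \<ge> 2 * d + 1\<close>, and
    the left side of \<open>ineq\<close> is \<open>k * (r + b)\<close> plus a nonnegative
    term.\<close>
  have r_small: "r < d" if "R1 \<noteq> {}"
  proof (rule ccontr)
    assume "\<not> r < d"
    then have rd: "r \<ge> d" by simp
    have "R2 \<subset> R" using that by (auto simp: R2_def R1_def)
    then have "card R2 < card R" by (rule psubset_card_mono[OF finR])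
    then have br: "b \<ge> r + 1" by (simp add: r_def b_def)
    have "k * (r + b) \<ge> k * (2 * d + 1)" using rd br k_min by (intro mult_left_mono) auto
    moreover have "y * (2 * k - 1 - y - r) \<ge> 0" using yk br b_le k_large by (intro mult_nonneg_nonneg) auto
    moreover have "y * (k - 1) + (k - y) * (y + r) + k * b = k * (r + b) + y * (2 * k - 1 - y - r)"
      by (simp add: algebra_simps)
    ultimately show False using ineq k_min by (simp add: algebra_simps)
  qed
  \<comment> \<open>This will force each vertex of \<open>R2\<close> to have a neighbour in
    \<open>R1\<close>. If it fails and \<open>Y\<close> is nonempty, the minimum degree at a vertex
    of \<open>Y\<close> gives \<open>b \<ge> d\<close>, and the two sides of \<open>ineq\<close>
    then differ by at least \<open>2 * k\<close> in the wrong direction.\<close>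
  have ry_small: "r + y \<le> d + 1" if "r \<ge> 1"
  proof (rule ccontr)
    assume "\<not> r + y \<le> d + 1"
    then have e: "r + y - d - 2 \<ge> 0" by simp
    show False
    proof (cases "Y = {}")
      case True
      then have "y = 0" by (simp add: y_def)
      then have "k * (r + b) \<le> k * (2 * d)" using ineq by (simp add: algebra_simps)
      then have "r + b \<le> 2 * d" using k_min by simp
      then show False using e rb \<open>y = 0\<close> by simp
    next
      case False
      then obtain u where u: "u \<in> Y" by blast
      have "E `` {u} \<subseteq> insert v0 R" using u nbV[of u] by (auto simp: Y_def R_def)
      then have "card (E `` {u}) \<le> card (insert v0 R)" using finR by (intro card_mono) auto
      then have "card (E `` {u}) \<le> card R + 1" using finR by (simp add: card_insert_if split: if_splits)
      then have bd: "b \<ge> d" using min_deg[of u] u NV by (auto simp: b_def Y_def)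
      have "k * (b - d) \<ge> 0" using bd k_min by simp
      moreover have "(k - y) * (r + y - d - 2) \<ge> 0" using yk e by simp
      moreover have "y * (k - d - 3) \<ge> 0" using yk k_large by simp
      moreover have "y * (k - 1) + (k - y) * (y + r) + k * b - 2 * d * k
          = k * (b - d) + (k - y) * (r + y - d - 2) + y * (k - d - 3) + 2 * k"
        by (simp add: algebra_simps)
      ultimately show False using ineq k_min by linarith
    qed
  qed

  \<comment> \<open>Without a neighbour in \<open>R1\<close>, the neighbours of \<open>w\<close> lie
    in \<open>Y\<close> and \<open>R2 - {w}\<close>: at most \<open>y + r - 1 \<le> d\<close> of
    them, one too few.\<close>
  have R2_nb: "E `` {w} \<inter> R1 \<noteq> {}" if w: "w \<in> R2" for w
  proof
    assume none: "E `` {w} \<inter> R1 = {}"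
    have pos: "card R2 \<ge> 1" using w finR12 by (auto simp: Suc_le_eq card_gt_0_iff)
    have wR: "w \<in> R" using w by (simp add: R2_def)
    have "(w, v0) \<notin> E" using wR sE by (auto simp: R_def N_def dest: symD)
    then have "E `` {w} \<subseteq> Y \<union> (R2 - {w})"
      using none nbV[of w] irr w unfolding R2_def R1_def R_def Z_def by blast
    then have "card (E `` {w}) \<le> card (Y \<union> (R2 - {w}))" using finY finR12 by (intro card_mono) auto
    also have "\<dots> \<le> card Y + card (R2 - {w})" by (rule card_Un_le)
    also have "int \<dots> = y + r - 1"
      using w pos by (simp add: y_def r_def card_Diff_singleton of_nat_diff)
    finally have "int (card (E `` {w})) \<le> y + r - 1" by simp
    moreover have "r \<ge> 1" using pos by (simp add: r_def)
    ultimately show False using ry_small min_deg[of w] wR by (auto simp: R_def)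
  qed

  \<comment> \<open>A path \<open>x y0 z\<close> inside \<open>N\<close>. If every vertex of
    \<open>N\<close> had at most one neighbour in \<open>N\<close>, each would miss at least
    \<open>k - 2\<close> vertices, forcing \<open>card V \<le> 2 * d + 3\<close>.\<close>
  obtain y0 x z where xyz: "y0 \<in> N" "x \<in> N" "z \<in> N" "(y0, x) \<in> E" "(y0, z) \<in> E" "x \<noteq> z"
  proof (rule ccontr)
    assume "\<not> thesis"
    then have uniq: "\<And>u x z. \<lbrakk>u \<in> N; x \<in> N; z \<in> N; (u, x) \<in> E; (u, z) \<in> E\<rbrakk> \<Longrightarrow> x = z"
      using that by blast
    have "int (card (M u)) \<ge> k - 2" if u: "u \<in> N" for u
    proof -
      have "card (E `` {u} \<inter> N) \<le> 1"
        using uniq[OF u] finN by (auto simp: card_le_Suc0_iff_eq)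
      moreover have "N \<subseteq> M u \<union> {u} \<union> (E `` {u} \<inter> N)" using NV by (auto simp: M_def)
      then have "card N \<le> card (M u \<union> {u} \<union> (E `` {u} \<inter> N))"
        using finM finN by (intro card_mono) auto
      then have "card N \<le> card (M u) + 1 + card (E `` {u} \<inter> N)"
        using card_Un_le[of "M u \<union> {u}" "E `` {u} \<inter> N"] card_Un_le[of "M u" "{u}"] by simp
      ultimately show ?thesis by (simp add: k_def)
    qed
    then have "k * (k - 2) \<le> (\<Sum>u\<in>N. int (card (M u)))"
      using sum_bounded_below[of N "k - 2" "\<lambda>u. int (card (M u))"] by (simp add: k_def)
    then have "k * (k - 2 + b) \<le> k * (2 * d)" using dense' by (simp add: algebra_simps)
    then have "k - 2 + b \<le> 2 * d" using k_min by simp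
    then show False using cardV large d by linarith
  qed
  have xyz': "x \<noteq> y0" "z \<noteq> y0" "x \<noteq> v0" "y0 \<noteq> v0" "z \<noteq> v0" "(v0, x) \<in> E" "(x, v0) \<in> E" "(x, y0) \<in> E"
    using xyz irr v0N sE by (auto simp: N_def dest: symD)
  have "x \<in> Z" "y0 \<in> Z" using xyz xyz' by (auto simp: Z_def Y_def)

  \<comment> \<open>Hanging \<open>x\<close> from \<open>y0\<close> makes \<open>v0 x\<close> a non-tree edge at \<open>v0\<close>; \<open>y0 z\<close> is one at \<open>y0\<close>.\<close>
  define p where "p v = (if v = v0 then v0 else if v = x then y0 else if v \<in> N then v0
    else if v \<in> R1 then SOME u. u \<in> E `` {v} \<inter> Z else SOME u. u \<in> E `` {v} \<inter> R1)" for v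
  \<comment> \<open>Since \<open>x\<close> lies one level below the rest of \<open>N\<close> and may
    be a parent for \<open>R1\<close>, the ranks of \<open>R1\<close> and \<open>R2\<close> start at
    3.\<close>
  define rank :: "'a \<Rightarrow> nat" where "rank v = (if v = v0 then 0 else if v = x then 2
    else if v \<in> N then 1 else if v \<in> R1 then 3 else 4)" for v
  have disj: "R1 \<inter> N = {}" "R2 \<inter> N = {}"
    "v0 \<notin> R1" "v0 \<notin> R2" "R2 \<inter> R1 = {}" "Z \<subseteq> N" "Y \<subseteq> N" "Y \<inter> Z = {}"
    by (auto simp: R1_def R2_def R_def Z_def Y_def)
  have V_cases: "v = v0 \<or> v \<in> Y \<or> v \<in> Z \<or> v \<in> R1 \<or> v \<in> R2" if "v \<in> V" for v
    using that by (auto simp: R2_def R_def Z_def)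
  \<comment> \<open>With the root as its own parent, \<open>u \<noteq> p v0\<close> excludes no
    neighbour of \<open>v0\<close>.\<close>
  have p_v0: "p v0 = v0" and p_x: "p x = y0" using xyz' by (auto simp: p_def)
  have p_N: "p v = v0" if "v \<in> N" "v \<noteq> x" for v using that v0N by (auto simp: p_def)
  have p_R1: "p w \<in> Z" "(w, p w) \<in> E" if w: "w \<in> R1" for w
  proof -
    have "p w = (SOME u. u \<in> E `` {w} \<inter> Z)" using w disj xyz by (auto simp: p_def)
    moreover have "E `` {w} \<inter> Z \<noteq> {}" using w by (simp add: R1_def)
    ultimately have "p w \<in> E `` {w} \<inter> Z" by (metis some_in_eq)
    then show "p w \<in> Z" "(w, p w) \<in> E" by auto
  qed
  have p_R2: "p w \<in> R1" "(w, p w) \<in> E" if w: "w \<in> R2" for w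
  proof -
    have "p w = (SOME u. u \<in> E `` {w} \<inter> R1)" using w disj xyz by (auto simp: p_def)
    then have "p w \<in> E `` {w} \<inter> R1" using R2_nb[OF w] by (metis some_in_eq)
    then show "p w \<in> R1" "(w, p w) \<in> E" by auto
  qed
  have p_range_N: "p u = v0 \<or> p u = y0" if "u \<in> N" for u
    using p_N[OF that] p_x by (cases "u = x") auto
  \<comment> \<open>Vertices of \<open>Y\<close> and \<open>R2\<close> are leaves, so for them any
    edge other than the one to the parent is a non-tree edge.\<close>
  have p_range: "p u \<in> insert v0 (Z \<union> R1)" if u: "u \<in> V" for u
  proof -
    consider "u = v0" | "u \<in> N" | "u \<in> R1" | "u \<in> R2" using V_cases[OF u] disj by auto
    then show ?thesis
      by cases (use p_v0 p_range_N[of u] p_R1(1)[of u] p_R2(1)[of u] \<open>y0 \<in> Z\<close> in auto)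
  qed
  have N_nb: "(v, v0) \<in> E" if "v \<in> N" for v using that sE by (auto simp: N_def dest: symD)

  have nontree: "\<exists>u. (v, u) \<in> E \<and> u \<noteq> p v \<and> v \<noteq> p u" if v: "v \<in> V" for v
  proof -
    have avoid: "\<exists>u \<in> E `` {v}. u \<notin> A" if "card A < card (E `` {v})" "finite A" for A
      using that by (metis card_mono leD subsetI)
    have E_V: "u \<in> V" if "(v, u) \<in> E" for u using that EV by auto
    have two: "card (E `` {v}) \<ge> 2" using min_deg[OF v] d by simp
    consider "v = v0" | "v \<in> Y" | "v \<in> Z" | "v \<in> R1" | "v \<in> R2" using V_cases[OF v] by blast
    then show ?thesis
    proof cases
      case 1
      then show ?thesis using xyz' p_v0 p_x by metis
    next
      case 2
      then have pv: "p v = v0" using p_N disj \<open>x \<in> Z\<close> by blast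
      obtain u where u: "(v, u) \<in> E" "u \<noteq> v0" using avoid[of "{v0}"] two by auto
      have "v \<noteq> p u" using p_range[OF E_V[OF u(1)]] 2 disj v0N by auto
      then show ?thesis using u pv by auto
    next
      case 3
      then have vN: "v \<in> N" "v \<noteq> v0" using disj v0N by auto
      show ?thesis
      \<comment> \<open>The vertex \<open>x\<close> uses its edge to \<open>v0\<close>, and
        \<open>y0\<close> its edge to \<open>z\<close>. Any other vertex of \<open>Z\<close> uses a
        neighbour in \<open>N\<close>, as parents of vertices of \<open>N\<close> are
        \<open>v0\<close> or \<open>y0\<close>.\<close>
      proof (cases "v = x \<or> v = y0")
        case True
        then show ?thesis
          using xyz xyz' p_x p_v0 p_N[of y0] p_N[of z] by metis
      next
        case False
        obtain u where u: "u \<in> N" "(v, u) \<in> E" using 3 by (auto simp: Z_def Y_def)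
        then show ?thesis using p_N[of v] p_range_N[of u] False vN v0N by metis
      qed
    next
      case 4
      \<comment> \<open>The parent and \<open>R2\<close> together have at most \<open>d\<close>
        vertices, so one of the \<open>d + 1\<close> neighbours of \<open>v\<close> avoids both. It
        lies in \<open>N\<close> or \<open>R1\<close>, where no vertex has its parent in
        \<open>R1\<close>.\<close>
      have r_lt: "card R2 < d" using r_small 4 by (force simp: r_def)
      have "card (insert (p v) R2) \<le> card R2 + 1" using finR12 by (simp add: card_insert_if)
      also have "\<dots> < card (E `` {v})" using r_lt min_deg[OF v] by simp
      finally obtain u where u: "(v, u) \<in> E" "u \<notin> R2" "u \<noteq> p v"
        using avoid[of "insert (p v) R2"] finR12 by auto
      have "u \<noteq> v0" using u 4 sE by (auto simp: R1_def R_def N_def dest: symD)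
      then have "u \<in> N \<or> u \<in> R1" using u V_cases[OF E_V[OF u(1)]] disj by auto
      then have "v \<noteq> p u" using p_range_N[of u] p_R1[of u] 4 disj xyz by auto
      then show ?thesis using u by auto
    next
      case 5
      obtain u where u: "(v, u) \<in> E" "u \<noteq> p v" using avoid[of "{p v}"] two by auto
      have "v \<noteq> p u" using p_range[OF E_V[OF u(1)]] 5 disj by auto
      then show ?thesis using u by auto
    qed
  qed
  have par: "(v, p v) \<in> E \<and> rank (p v) < rank v" if v: "v \<in> V" "v \<noteq> v0" for v
  proof (cases "v = x")
    case True
    then show ?thesis using xyz xyz' p_x by (auto simp: rank_def)
  next
    case False
    consider "v \<in> N" | "v \<in> R1" | "v \<in> R2" using V_cases[OF v(1)] v(2) disj by auto
    then show ?thesis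
    proof cases
      case 1
      then show ?thesis using False N_nb p_N v by (auto simp: rank_def)
    next
      case 2
      then have "p v \<in> N" "rank v = 3" using p_R1 disj False v by (auto simp: rank_def)
      then show ?thesis using p_R1[OF 2] by (simp add: rank_def)
    next
      case 3
      then have "p v \<in> R1" "rank v = 4" using p_R2 disj False v by (auto simp: rank_def)
      moreover have "rank (p v) = 3" using \<open>p v \<in> R1\<close> disj xyz by (auto simp: rank_def)
      ultimately show ?thesis using p_R2[OF 3] by simp
    qed
  qed
  show thesis
    using even_spanning_subgraph_from_tree[of V E v0 p rank, OF fin EV sE iE par nontree] that by blast
qed

section \<open>The signless Laplacian radius\<close>

text \<open>
  If \<open>A (x + \<i> y) = (a + \<i> b) (x + \<i> y)\<close> with real \<open>x\<close>, \<open>y\<close>, then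
  \<open>y \<bullet> A x = x \<bullet> A y\<close> gives \<open>b (\<bar>x\<bar>\<^sup>2 + \<bar>y\<bar>\<^sup>2) = 0\<close>.
\<close>

lemma spectrum_nonempty_symmetric:
  fixes A :: "real mat"
  assumes A: "A \<in> carrier_mat n n" and n: "n > 0"
    and symm: "\<And>i j. i < n \<Longrightarrow> j < n \<Longrightarrow> A $$ (i, j) = A $$ (j, i)"
  shows "spectrum A \<noteq> {}"
proof -
  let ?B = "map_mat complex_of_real A"
  have "spectrum ?B \<noteq> {}" using A n by (intro spectrum_non_empty[where n = n]) auto
  then obtain l v where "eigenvector ?B v l" by (auto simp: spectrum_def eigenvalue_def)
  then have v: "v \<in> carrier_vec n" "v \<noteq> 0\<^sub>v n" "?B *\<^sub>v v = l \<cdot>\<^sub>v v"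
    using A by (auto simp: eigenvector_def)
  define x y where "x i = Re (v $ i)" and "y i = Im (v $ i)" for i
  have ev: "(\<Sum>j<n. complex_of_real (A $$ (i, j)) * v $ j) = l * v $ i" if i: "i < n" for i
  proof -
    have "l * v $ i = (?B *\<^sub>v v) $ i" using v i by simp
    also have "(?B *\<^sub>v v) $ i = (\<Sum>j<n. ?B $$ (i, j) * v $ j)"
      using i A v(1) by (simp add: scalar_prod_def atLeast0LessThan del: index_map_mat)
    also have "\<dots> = (\<Sum>j<n. complex_of_real (A $$ (i, j)) * v $ j)"
      using i A by (intro sum.cong) auto
    finally show ?thesis by (rule sym)
  qed
  have Ax: "(\<Sum>j<n. A $$ (i, j) * x j) = Re l * x i - Im l * y i" if "i < n" for i
    using arg_cong[OF ev[OF that], of Re] by (simp add: x_def y_def)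
  have Ay: "(\<Sum>j<n. A $$ (i, j) * y j) = Re l * y i + Im l * x i" if "i < n" for i
    using arg_cong[OF ev[OF that], of Im] by (simp add: x_def y_def)
  obtain i where i: "i < n" "v $ i \<noteq> 0" using v by (metis eq_vecI carrier_vecD index_zero_vec)
  have "(\<Sum>i<n. y i * (\<Sum>j<n. A $$ (i, j) * x j)) = (\<Sum>j<n. \<Sum>i<n. y i * (A $$ (i, j) * x j))"
    unfolding sum_distrib_left by (rule sum.swap)
  also have "\<dots> = (\<Sum>j<n. x j * (\<Sum>i<n. A $$ (j, i) * y i))"
    unfolding sum_distrib_left by (intro sum.cong refl) (use symm in \<open>auto simp: mult_ac\<close>)
  finally have "(\<Sum>i<n. y i * (Re l * x i - Im l * y i)) = (\<Sum>i<n. x i * (Re l * y i + Im l * x i))"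
    using Ax Ay by simp
  then have "(\<Sum>i<n. Im l * (x i * x i + y i * y i)) = 0"
    by (simp add: algebra_simps sum.distrib sum_subtractf)
  then have "Im l * (\<Sum>i<n. x i * x i + y i * y i) = 0" by (simp only: sum_distrib_left)
  moreover have "(\<Sum>i<n. x i * x i + y i * y i) > 0"
  proof (rule sum_pos2[where i = i])
    show "0 < x i * x i + y i * y i"
      using i by (auto simp: x_def y_def complex_eq_iff sum_squares_gt_zero_iff)
  qed (use i in auto)
  ultimately have real: "Im l = 0" by simp
  \<comment> \<open>Once \<open>l\<close> is real, the real and the imaginary part of
    \<open>v\<close> both satisfy the eigenvector equation; at least one of them is nonzero at
    \<open>i\<close>.\<close>
  have "eigenvector A (vec n z) (Re l)"
    if "\<And>i. i < n \<Longrightarrow> (\<Sum>j<n. A $$ (i, j) * z j) = Re l * z i" "z i \<noteq> 0" for z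
    unfolding eigenvector_def
  proof (intro conjI)
    show "vec n z \<in> carrier_vec (dim_row A)" using A by simp
    show "vec n z \<noteq> 0\<^sub>v (dim_row A)" using A that(2) i by (metis carrier_matD(1) index_vec index_zero_vec(1))
    show "A *\<^sub>v vec n z = Re l \<cdot>\<^sub>v vec n z"
      using A that(1) by (intro eq_vecI) (auto simp: scalar_prod_def atLeast0LessThan)
  qed
  moreover have "x i \<noteq> 0 \<or> y i \<noteq> 0" using i by (simp add: x_def y_def complex_eq_iff)
  ultimately have "\<exists>w. eigenvector A w (Re l)" using Ax Ay real by auto
  then show ?thesis by (auto simp: spectrum_def eigenvalue_def)
qed

section \<open>Eigenvectors as vertex weights\<close>

lemma degree_of_eq_card: "degree_of G v = card (parcs G `` {v})"
proof -
  have "out_arcs (with_proj G) v = Pair v ` (parcs G `` {v})" by (auto simp: out_arcs_def)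
  then show ?thesis by (simp add: out_degree_def card_image inj_on_def)
qed

lemma signless_laplacian_carrier:
  "signless_laplacian G \<in> carrier_mat (order_of G) (order_of G)"
  by (simp add: signless_laplacian_def degree_matrix_def adjacency_matrix_def)

text \<open>Carrying vectors along the enumeration of the vertices turns them into weights
  \<open>x\<close> on the vertices, and the degree and adjacency entries of row \<open>w\<close>
  combine into one sum over neighbours.\<close>

lemma spectrum_signless_laplacian_iff:
  assumes fin: "finite (pverts G)" and wf: "parcs G \<subseteq> pverts G \<times> pverts G"
  shows "l \<in> spectrum (signless_laplacian G) \<longleftrightarrow>
    (\<exists>x. (\<exists>u\<in>pverts G. x u \<noteq> 0) \<and>
      (\<forall>w\<in>pverts G. l * x w = (\<Sum>u\<in>parcs G `` {w}. x w + x u)))"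
proof -
  define V n Q f where "V = pverts G" and "n = order_of G" and "Q = signless_laplacian G"
    and "f = from_nat_into (pverts G)"
  have bij: "bij_betw f {..<n} V"
    using bij_betw_from_nat_into_finite[OF fin] by (simp add: V_def n_def f_def)
  have fV: "f i \<in> V" if "i < n" for i using bij that by (auto simp: bij_betw_def)
  have Q: "Q \<in> carrier_mat n n" using signless_laplacian_carrier by (simp add: Q_def n_def)
  have nb: "finite (parcs G `` {w})" "parcs G `` {w} \<subseteq> V" for w
    using wf fin finite_subset[of "parcs G `` {w}" V] by (auto simp: V_def)
  have mult: "(Q *\<^sub>v vec n (\<lambda>j. x (f j))) $ i = (\<Sum>u\<in>parcs G `` {f i}. x (f i) + x u)"
    if i: "i < n" for i and x :: "'a \<Rightarrow> real"
  proof -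
    have "(Q *\<^sub>v vec n (\<lambda>j. x (f j))) $ i = (\<Sum>j<n. Q $$ (i, j) * x (f j))"
      using i Q by (simp add: scalar_prod_def atLeast0LessThan)
    also have "\<dots> = (\<Sum>j<n. (if j = i then real (degree_of G (f i)) * x (f i) else 0)
        + (if (f i, f j) \<in> parcs G then x (f j) else 0))"
      using i by (intro sum.cong)
        (auto simp: Q_def signless_laplacian_def degree_matrix_def adjacency_matrix_def f_def n_def algebra_simps)
    also have "\<dots> = real (degree_of G (f i)) * x (f i)
        + (\<Sum>j<n. if (f i, f j) \<in> parcs G then x (f j) else 0)"
      using i by (simp add: sum.distrib)
    also have "(\<Sum>j<n. if (f i, f j) \<in> parcs G then x (f j) else 0)
        = (\<Sum>u\<in>V. if (f i, u) \<in> parcs G then x u else 0)"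
      by (rule sum.reindex_bij_betw[OF bij])
    also have "\<dots> = (\<Sum>u\<in>parcs G `` {f i}. x u)"
      using nb[of "f i"] fin by (intro sum.mono_neutral_cong_right) (auto simp: V_def)
    finally show ?thesis by (simp add: degree_of_eq_card sum.distrib)
  qed
  show ?thesis
  proof
    assume "l \<in> spectrum (signless_laplacian G)"
    then obtain v where "eigenvector Q v l" by (auto simp: spectrum_def eigenvalue_def Q_def)
    then have v: "v \<in> carrier_vec n" "v \<noteq> 0\<^sub>v n" "Q *\<^sub>v v = l \<cdot>\<^sub>v v"
      using Q by (auto simp: eigenvector_def)
    define x where "x u = v $ (the_inv_into {..<n} f u)" for u
    have xf: "x (f j) = v $ j" if "j < n" for j
      using that bij by (simp add: x_def bij_betw_def the_inv_into_f_f)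
    have vx: "v = vec n (\<lambda>j. x (f j))" using v(1) xf by (intro eq_vecI) auto
    obtain i where i: "i < n" "v $ i \<noteq> 0" using v by (metis eq_vecI carrier_vecD index_zero_vec)
    have "l * x w = (\<Sum>u\<in>parcs G `` {w}. x w + x u)" if w: "w \<in> V" for w
    proof -
      obtain j where j: "j < n" "w = f j" using bij w by (auto simp: bij_betw_def)
      have "(Q *\<^sub>v v) $ j = l * v $ j" using v j by simp
      then show ?thesis using mult[OF j(1), of x] xf[OF j(1)] j(2) by (simp flip: vx)
    qed
    then show "\<exists>x. (\<exists>u\<in>pverts G. x u \<noteq> 0) \<and>
        (\<forall>w\<in>pverts G. l * x w = (\<Sum>u\<in>parcs G `` {w}. x w + x u))"
      using i fV[OF i(1)] xf[OF i(1)] by (intro exI[of _ x] conjI bexI[of _ "f i"]) (auto simp: V_def)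
  next
    assume "\<exists>x. (\<exists>u\<in>pverts G. x u \<noteq> 0) \<and>
        (\<forall>w\<in>pverts G. l * x w = (\<Sum>u\<in>parcs G `` {w}. x w + x u))"
    then obtain x u where x: "u \<in> V" "x u \<noteq> 0"
      "\<And>w. w \<in> V \<Longrightarrow> l * x w = (\<Sum>u\<in>parcs G `` {w}. x w + x u)" by (auto simp: V_def)
    obtain i where i: "i < n" "u = f i" using bij x(1) by (auto simp: bij_betw_def)
    let ?v = "vec n (\<lambda>j. x (f j))"
    have "?v $ i \<noteq> 0\<^sub>v n $ i" using i x by simp
    then have "?v \<noteq> 0\<^sub>v n" by metis
    moreover have "Q *\<^sub>v ?v = l \<cdot>\<^sub>v ?v"
      using Q x(3) mult fV by (intro eq_vecI) auto
    ultimately have "eigenvector Q ?v l" using Q by (auto simp: eigenvector_def)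
    then show "l \<in> spectrum (signless_laplacian G)" by (auto simp: spectrum_def eigenvalue_def Q_def)
  qed
qed

text \<open>
  The vertex \<open>w\<close> is one where \<open>\<bar>x w\<bar> / d(w)\<close> is maximal; divided by \<open>d(w)\<close>, the right-hand side
  is \<open>d(w) + m(w)\<close>.
\<close>

lemma merris_bound:
  fixes x :: "'a \<Rightarrow> real"
  assumes fin: "finite V" and EV: "E \<subseteq> V \<times> V"
    and deg: "\<And>w. w \<in> V \<Longrightarrow> card (E `` {w}) > 0"
    and nz: "u \<in> V" "x u \<noteq> 0"
    and ev: "\<And>w. w \<in> V \<Longrightarrow> l * x w = (\<Sum>u\<in>E `` {w}. x w + x u)"
  obtains w where "w \<in> V"
    "l * card (E `` {w}) \<le> (\<Sum>u\<in>E `` {w}. real (card (E `` {w})) + real (card (E `` {u})))"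
proof -
  define d where "d w = real (card (E `` {w}))" for w
  define M where "M = Max ((\<lambda>w. \<bar>x w\<bar> / d w) ` V)"
  have d: "d w > 0" if "w \<in> V" for w using deg[OF that] by (simp add: d_def)
  have le: "\<bar>x w\<bar> \<le> M * d w" if "w \<in> V" for w
  proof -
    have "\<bar>x w\<bar> / d w \<le> M" using that fin by (auto simp: M_def)
    then show ?thesis using d[OF that] by (simp add: field_simps)
  qed
  have "M \<in> (\<lambda>w. \<bar>x w\<bar> / d w) ` V" unfolding M_def using nz fin by (intro Max_in) auto
  then obtain w where w: "w \<in> V" "M = \<bar>x w\<bar> / d w" by blast
  have xw: "\<bar>x w\<bar> = M * d w" using w d[OF w(1)] by simp
  have "0 < M * d u" using le[OF nz(1)] nz(2) by linarith
  then have M: "M > 0" using d[OF nz(1)] by (simp add: zero_less_mult_iff)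
  \<comment> \<open>Valid for either sign of \<open>l\<close>, as
    \<open>l \<le> \<bar>l\<bar>\<close>.\<close>
  have "M * (l * d w) \<le> \<bar>l * x w\<bar>" by (simp add: abs_mult xw mult_ac mult_right_mono M d[OF w(1)] less_imp_le)
  also have "\<dots> \<le> (\<Sum>u\<in>E `` {w}. \<bar>x w + x u\<bar>)" unfolding ev[OF w(1)] by (rule sum_abs)
  also have "\<dots> \<le> (\<Sum>u\<in>E `` {w}. M * (d w + d u))"
  proof (rule sum_mono)
    fix u assume "u \<in> E `` {w}"
    then have "u \<in> V" using EV by auto
    then show "\<bar>x w + x u\<bar> \<le> M * (d w + d u)" using le[of u] xw by (simp add: distrib_left)
  qed
  also have "\<dots> = M * (\<Sum>u\<in>E `` {w}. d w + d u)" by (rule sum_distrib_left[symmetric])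
  finally have "l * d w \<le> (\<Sum>u\<in>E `` {w}. d w + d u)" using M by simp
  then show thesis using that[OF w(1)] by (simp add: d_def)
qed

lemma radius_of_vertex_weights:
  assumes fin: "finite (pverts G)" and wf: "parcs G \<subseteq> pverts G \<times> pverts G"
    and "u \<in> pverts G" "x u \<noteq> 0"
    and "\<And>w. w \<in> pverts G \<Longrightarrow> l * x w = (\<Sum>u\<in>parcs G `` {w}. x w + x u)"
  shows "l \<le> signless_laplacian_radius G"
proof -
  have "l \<in> spectrum (signless_laplacian G)"
    unfolding spectrum_signless_laplacian_iff[OF fin wf] using assms(3-5) by blast
  then show ?thesis
    unfolding signless_laplacian_radius_def
    using card_finite_spectrum(1)[OF signless_laplacian_carrier] by (rule Max_ge[rotated])
qed

text \<open>\<open>Max\<close> is meaningful only on finite nonempty sets; symmetry of the matrix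
  supplies a real eigenvalue.\<close>

lemma radius_in_spectrum:
  assumes fin: "finite (pverts G)" and ne: "pverts G \<noteq> {}" and symm: "sym (parcs G)"
  shows "signless_laplacian_radius G \<in> spectrum (signless_laplacian G)"
  unfolding signless_laplacian_radius_def
proof (rule Max_in)
  show "finite (spectrum (signless_laplacian G))"
    by (rule card_finite_spectrum(1)[OF signless_laplacian_carrier])
  show "spectrum (signless_laplacian G) \<noteq> {}"
  proof (rule spectrum_nonempty_symmetric[OF signless_laplacian_carrier])
    show "order_of G > 0" using fin ne by (simp add: card_gt_0_iff)
    show "signless_laplacian G $$ (i, j) = signless_laplacian G $$ (j, i)"
      if "i < order_of G" "j < order_of G" for i j
      using that symm
      by (auto simp: signless_laplacian_def degree_matrix_def adjacency_matrix_def dest: symD)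
  qed
qed

text \<open>
  The witness is an eigenvector that is constant on the three classes of the
  equitable partition; its eigenvalue is a zero of \<open>g\<close>.
\<close>

lemma extremal_radius_ge:
  assumes d: "\<delta> \<ge> 1" and n: "n \<ge> 2 * \<delta>"
  shows "signless_laplacian_radius (extremal_graph n \<delta>) \<ge> 2 * (real n - real \<delta>)"
proof -
  define D m K where "D = real \<delta>" and "m = real n" and "K = m - 2 * D + 1"
  have D: "D \<ge> 1" "m \<ge> 2 * D" using d n by (auto simp: D_def m_def)
  have K: "K \<ge> 1" using D by (simp add: K_def)
  \<comment> \<open>Give weight 1 to the dominating clique, \<open>b\<close> to the other clique and
    \<open>c\<close> to the isolated vertices. Solving the last two eigenvector equations for
    \<open>b\<close> and \<open>c\<close> and substituting into the first yields
    \<open>g l = 0\<close>.\<close>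
  define g where "g l = l - (m + D - 2) - K * (D / (l - (2 * m - 3 * D))) - (D - 1) * (D / (l - D))" for l
  \<comment> \<open>This is the radius of the clique on \<open>n - \<delta> + 1\<close> vertices;
    here \<open>b\<close> would be 1, which collapses the expression.\<close>
  have lower: "g (2 * m - 2 * D) \<le> 0"
  proof -
    have "(D - 1) * (D / (2 * m - 2 * D - D)) \<ge> 0" using D by (intro mult_nonneg_nonneg divide_nonneg_nonneg) auto
    moreover have "g (2 * m - 2 * D) = 1 - D - (D - 1) * (D / (2 * m - 2 * D - D))"
      using D by (simp add: g_def K_def)
    ultimately show ?thesis using D(1) by linarith
  qed
  \<comment> \<open>Here \<open>b\<close> would be \<open>1 / 3\<close>, and \<open>c\<close> at
    most 1.\<close>
  have upper: "g (2 * m) \<ge> 0"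
  proof -
    define t where "t = (D - 1) * (D / (2 * m - D))"
    have "D / (2 * m - D) \<le> 1" using D by (simp add: field_simps)
    then have "t \<le> (D - 1) * 1" unfolding t_def using D by (intro mult_left_mono) auto
    then have "t \<le> D - 1" by simp
    moreover have "g (2 * m) = m - D + 2 - K / 3 - t" using D by (simp add: g_def t_def)
    ultimately show ?thesis using D K_def by linarith
  qed
  \<comment> \<open>Both denominators are at least \<open>D\<close> on this interval.\<close>
  have "continuous_on {2 * m - 2 * D..2 * m} g"
    unfolding g_def using D by (intro continuous_intros) auto
  then obtain l where l: "2 * m - 2 * D \<le> l" "l \<le> 2 * m" "g l = 0"
    using IVT'[of g "2 * m - 2 * D" 0 "2 * m"] lower upper D by auto
  define b c where "b = D / (l - (2 * m - 3 * D))" and "c = D / (l - D)"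
  have b: "l * b = D * (b + 1) + (K - 1) * (2 * b)"
  proof -
    have "b * (l - (2 * m - 3 * D)) = D" using l D by (simp add: b_def)
    then show ?thesis by (simp add: K_def algebra_simps)
  qed
  have c: "l * c = D * (c + 1)"
  proof -
    have "c * (l - D) = D" using l D by (simp add: c_def)
    then show ?thesis by (simp add: algebra_simps)
  qed
  have a: "l = (D - 1) * 2 + K * (1 + b) + (D - 1) * (1 + c)"
  proof -
    have "g l = l - (m + D - 2) - K * b - (D - 1) * c" by (simp add: g_def b_def c_def)
    then show ?thesis using l(3) by (simp add: K_def algebra_simps)
  qed
  define H where "H = extremal_graph n \<delta>"
  define k where "k = n - 2 * \<delta> + 1"
  have k: "real k = K" using n by (simp add: k_def K_def m_def D_def of_nat_diff)
  define x :: "nat + nat + nat \<times> nat \<Rightarrow> real"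
    where "x = case_sum (\<lambda>_. 1) (case_sum (\<lambda>_. b) (\<lambda>_. c))"
  note graph_defs = H_def extremal_graph_def graph_join_def disjoint_union_def complete_graph_def
    copies_def k_def
  have verts: "pverts H = Inl ` {..<\<delta>} \<union> (\<lambda>j. Inr (Inl j)) ` {..<k} \<union> (\<lambda>i. Inr (Inr (i, 0))) ` {..<\<delta> - 1}"
    by (auto simp: graph_defs Plus_def image_iff)
  have nb1: "parcs H `` {Inl i} = Inl ` ({..<\<delta>} - {i}) \<union> (\<lambda>j. Inr (Inl j)) ` {..<k}
      \<union> (\<lambda>i. Inr (Inr (i, 0))) ` {..<\<delta> - 1}" if "i < \<delta>" for i
    using that by (auto simp: graph_defs Plus_def image_iff)
  have nb2: "parcs H `` {Inr (Inl j)} = Inl ` {..<\<delta>} \<union> (\<lambda>j. Inr (Inl j)) ` ({..<k} - {j})"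
    if "j < k" for j
    using that by (auto simp: graph_defs Plus_def image_iff)
  have nb3: "parcs H `` {Inr (Inr (i, 0))} = Inl ` {..<\<delta>}" if "i < \<delta> - 1" for i
    using that by (auto simp: graph_defs Plus_def image_iff)
  have inj: "inj_on Inl A" "inj_on (\<lambda>j. Inr (Inl j)) A" "inj_on (\<lambda>i. Inr (Inr (i, 0))) A"
    for A :: "nat set" by (auto simp: inj_on_def)
  have sums: "sum h (Inl ` A \<union> (\<lambda>j. Inr (Inl j)) ` B \<union> (\<lambda>i. Inr (Inr (i, 0))) ` C)
      = (\<Sum>i\<in>A. h (Inl i)) + (\<Sum>j\<in>B. h (Inr (Inl j))) + (\<Sum>i\<in>C. h (Inr (Inr (i, 0))))"
    if "finite A" "finite B" "finite C" for A B C and h :: "nat + nat + nat \<times> nat \<Rightarrow> real"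
    using that by (subst sum.union_disjoint, simp_all, blast, subst sum.union_disjoint)
      (auto simp: sum.reindex[OF inj(1)] sum.reindex[OF inj(2)] sum.reindex[OF inj(3)])
  have "2 * m - 2 * D \<le> l" by (rule l)
  also have "l \<le> signless_laplacian_radius H"
  proof (rule radius_of_vertex_weights)
    show "finite (pverts H)" by (simp add: verts)
    show "parcs H \<subseteq> pverts H \<times> pverts H" by (auto simp: graph_defs Plus_def)
    show "Inl 0 \<in> pverts H" using d by (simp add: verts)
    show "x (Inl 0) \<noteq> 0" by (simp add: x_def)
    fix w assume "w \<in> pverts H"
    then consider i where "w = Inl i" "i < \<delta>" | j where "w = Inr (Inl j)" "j < k"
      | i where "w = Inr (Inr (i, 0))" "i < \<delta> - 1" by (auto simp: verts)
    then show "l * x w = (\<Sum>u\<in>parcs H `` {w}. x w + x u)"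
    proof cases
      case 1
      then show ?thesis using a d k unfolding 1(1) nb1[OF 1(2)]
        by (subst sums) (simp_all add: x_def card_Diff_singleton of_nat_diff D_def)
    next
      case 2
      then show ?thesis using b k unfolding 2(1) nb2[OF 2(2)]
        using sums[of "{..<\<delta>}" "{..<k} - {j}" "{}"]
        by (simp add: x_def card_Diff_singleton of_nat_diff D_def)
    next
      case 3
      then show ?thesis using c unfolding 3(1) nb3[OF 3(2)]
        using sums[of "{..<\<delta>}" "{}" "{}"] by (simp add: x_def D_def)
    qed
  qed
  finally show ?thesis by (simp add: H_def m_def D_def)
qed

section \<open>From the spectral condition to the even factor\<close>

theorem theorem1p1:
  fixes G :: "'a pair_pre_digraph" and n \<delta> :: nat
  assumes "pair_graph G"
    and "Digraph_Component.connected (with_proj G)"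
    and "order_of G = n" and "even n"
    and "min_degree G = \<delta>"
    and "\<delta> \<ge> 2" and "n \<ge> 7 * \<delta> - 7"
    and "signless_laplacian_radius G \<ge> signless_laplacian_radius (extremal_graph n \<delta>)"
    and "\<not> digraph_iso (with_proj G) (with_proj (extremal_graph n \<delta>))"
  shows "\<exists>F. even_factor F G"
proof -
  interpret pair_graph G by fact
  define V E d where "V = pverts G" and "E = parcs G" and "d = \<delta> - 1"
  have fin: "finite V" by (simp add: V_def pair_finite_verts)
  have EV: "E \<subseteq> V \<times> V" using wellformed' by (auto simp: V_def E_def)
  have sE: "sym E" using pair_sym_arcs by (simp add: E_def symmetric_def)
  have iE: "irrefl E" using pair_no_loops by (force simp: E_def irrefl_def)
  have d: "d \<ge> 1" "\<delta> = d + 1" using assms(6) by (auto simp: d_def)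
  have cardV: "card V = n" using assms(3) by (simp add: V_def)
  \<comment> \<open>For \<open>d = 1\<close> the bound gives only 7, which the parity of
    \<open>n\<close> raises to 8.\<close>
  have large: "n \<ge> 7 * d" "n \<ge> 8"
    using assms(4,7) d by (auto simp: elim!: evenE)
  have ne: "V \<noteq> {}" using cardV large by auto
  have min_deg: "card (E `` {v}) \<ge> d + 1" if "v \<in> V" for v
  proof -
    have "min_degree G \<le> degree_of G v"
      unfolding min_degree_def using that fin by (intro Min_le) (auto simp: V_def)
    then show ?thesis using assms(5) d(2) by (simp add: degree_of_eq_card E_def)
  qed
  define q where "q = signless_laplacian_radius G"
  have "q \<in> spectrum (signless_laplacian G)"
    unfolding q_def using fin ne sE by (intro radius_in_spectrum) (auto simp: V_def E_def)
  then obtain x u where x: "u \<in> V" "x u \<noteq> 0"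
    "\<And>w. w \<in> V \<Longrightarrow> q * x w = (\<Sum>u\<in>E `` {w}. x w + x u)"
    using spectrum_signless_laplacian_iff[of G q] fin EV by (auto simp: V_def E_def)
  have "card (E `` {w}) > 0" if "w \<in> V" for w using min_deg[OF that] by simp
  then obtain w where w: "w \<in> V"
    "q * card (E `` {w}) \<le> (\<Sum>u\<in>E `` {w}. real (card (E `` {w})) + real (card (E `` {u})))"
    by (rule merris_bound[OF fin EV _ x])
  have "2 * (real n - real \<delta>) \<le> q"
    using extremal_radius_ge[of \<delta> n] assms(8) d large by (simp add: q_def)
  \<comment> \<open>Merris's inequality at \<open>w\<close>, with \<open>n - \<delta>\<close>
    rewritten as \<open>n - 1 - d\<close>.\<close>
  then have q: "2 * (real n - 1 - real d) * card (E `` {w})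
      \<le> (\<Sum>u\<in>E `` {w}. real (card (E `` {w})) + real (card (E `` {u})))"
    using w(2) d(2) by (smt (verit) mult_right_mono of_nat_0_le_iff of_nat_1 of_nat_add)
  have compl: "real (card (V - E `` {v} - {v})) = real n - 1 - real (card (E `` {v}))" if v: "v \<in> V" for v
  proof -
    have "V = insert v (E `` {v} \<union> (V - E `` {v} - {v}))" using v EV by auto
    moreover have "card (insert v (E `` {v} \<union> (V - E `` {v} - {v})))
        = 1 + card (E `` {v}) + card (V - E `` {v} - {v})"
    proof -
      have f: "finite (E `` {v})" using EV fin finite_subset[of "E `` {v}" V] by auto
      then have "card (E `` {v} \<union> (V - E `` {v} - {v})) = card (E `` {v}) + card (V - E `` {v} - {v})"
        using fin by (intro card_Un_disjoint) auto
      then show ?thesis using f fin iE by (simp add: irrefl_def)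
    qed
    ultimately show ?thesis using cardV by simp
  qed
  \<comment> \<open>Each degree is \<open>n - 1\<close> minus the number of non-neighbours, so the
    lower bound on the degree sum becomes an upper bound on missing edges.\<close>
  have "(\<Sum>u\<in>E `` {w}. real (card (V - E `` {w} - {w})) + real (card (V - E `` {u} - {u})))
      = (\<Sum>u\<in>E `` {w}. 2 * (real n - 1) - (real (card (E `` {w})) + real (card (E `` {u}))))"
    using compl EV w(1) by (intro sum.cong) auto
  also have "\<dots> = 2 * (real n - 1) * card (E `` {w})
      - (\<Sum>u\<in>E `` {w}. real (card (E `` {w})) + real (card (E `` {u})))"
    by (simp only: sum_subtractf sum_constant mult.commute)
  also have "\<dots> \<le> 2 * d * card (E `` {w})" using q by (simp add: algebra_simps)
  finally have "real (\<Sum>u\<in>E `` {w}. card (V - E `` {w} - {w}) + card (V - E `` {u} - {u}))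
      \<le> real (2 * d * card (E `` {w}))" by simp
  then have dense: "(\<Sum>u\<in>E `` {w}. card (V - E `` {w} - {w}) + card (V - E `` {u} - {u}))
      \<le> 2 * d * card (E `` {w})" by (simp only: of_nat_le_iff)
  obtain F where F: "F \<subseteq> E" "sym F"
    "\<And>v. v \<in> V \<Longrightarrow> even (card (F `` {v})) \<and> F `` {v} \<noteq> {}"
    using even_spanning_subgraph_of_dense[OF fin EV sE iE d(1) _ _ min_deg w(1) dense] cardV large
    by metis
  define H where "H = \<lparr>pverts = V, parcs = F\<rparr>"
  have H: "pair_graph H"
  proof
    show "finite (parcs H)" using finite_subset[OF F(1)] pair_finite_arcs by (simp add: H_def E_def)
    show "symmetric (with_proj H)" using F(2) by (simp add: symmetric_def H_def)
    show "\<And>e. e \<in> parcs H \<Longrightarrow> fst e \<noteq> snd e" using F(1) pair_no_loops by (auto simp: H_def E_def)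
  qed (use F(1) EV fin in \<open>auto simp: H_def\<close>)
  then interpret H: pair_graph H .
  have "spanning (with_proj H) (with_proj G)"
    using F(1) H.wf_digraph wf_digraph
    by (auto simp: spanning_def subgraph_def compatible_def H_def V_def E_def)
  \<comment> \<open>Evenness alone allows degree 0; a finite nonempty neighbourhood excludes
    it.\<close>
  moreover have "\<exists>k\<ge>1. degree_of H v = 2 * k" if v: "v \<in> V" for v
  proof -
    have "finite (F `` {v})" using F(1) EV fin finite_subset[of "F `` {v}" V] by auto
    then have "card (F `` {v}) \<noteq> 0" using F(3)[OF v] by simp
    moreover obtain k where "card (F `` {v}) = 2 * k" using F(3)[OF v] by blast
    ultimately show ?thesis by (intro exI[of _ k]) (auto simp: degree_of_eq_card H_def)
  qed
  ultimately show ?thesis using H by (auto simp: even_factor_def V_def)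
qed

end
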